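(* Let $G$ be a connected weighted graph on the node set $V=\{1,\dots,n\}$ with weighted Laplacian $L$ and Moore–Penrose pseudoinverse $L^+$. Let $\mu\in\mathbb{R}^n$ satisfy $\mathbf 1^T\mu=0$, and let $\omega$ be a random vector in $\mathbb{R}^n$ with mean zero, finite second moments, covariance matrix $\Sigma$, and $\sigma^2:=\mathbf 1^T\Sigma\mathbf 1>0$. Let $1\le k<n$ and $B=\{1,\dots,k\}$. Consider the optimization problem $$\min_{\alpha\in\mathbb{R}^n}\ \mathbb{E}\,\mathcal H_s(\alpha)\quad\text{subject to}\quad \mathbf 1^T\alpha=1,\qquad \alpha_v=0\ \text{ for all } v\in V\setminus B .$$ Let $P_B\in\{0,1\}^{n\times k}$ be the matrix whose first $k$ rows form the identity $I_k$ and whose other rows are zero, let $L_B^+:=P_B^TL^+P_B$ be the leading $k\times k$ principal submatrix of $L^+$, and let $t_B:=\mathbf 1^T(L_B^+)^{-1}\mathbf 1$ (here $\mathbf 1\in\mathbb{R}^k$). Then $L_B^+$ is invertible, $t_B>0$, and the (unique) solution of the problem is $\alpha^*=P_B\widetilde\alpha^*=(\widetilde\alpha^*,\mathbf 0)$ with $$\widetilde\alpha^*=\frac1{t_B}(L_B^+)^{-1}\mathbf 1+\Big(I_k-\frac1{t_B}(L_B^+)^{-1}\mathbf 1\mathbf 1^T\Big)(L_B^+)^{-1}P_B^TL^+\frac{\Sigma\mathbf 1}{\sigma^2}\in\mathbb{R}^k ,$$ where in $\Sigma\mathbf 1$ the vector $\mathbf 1$ is in $\mathbb{R}^n$ and in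 all other places of this formula it is in $\mathbb{R}^k$. Moreover, if $S\subseteq B$, where $S\subseteq V$ is the set of nodes with stochastic load fluctuations, then $$\widetilde\alpha^*=P_B^T\,\frac{\Sigma\mathbf 1}{\sigma^2}\qquad\Big(\text{i.e. } \alpha^*=\frac{\Sigma\mathbf 1}{\sigma^2}\Big),$$ and, in particular, $\widetilde\alpha^*_v=0$ for every $v\in B\setminus S$.
   Context: Weighted graph: simple undirected graph on $V=\{1,\dots,n\}$ with symmetric edge weights $\beta_{i,j}=\beta_{j,i}\ge 0$ ($i\ne j$); a missing edge is the same as an edge of weight $0$, and connectedness refers to the edges of positive weight. The weighted Laplacian is $L_{i,i}=\sum_{j\ne i}\beta_{i,j}$, $L_{i,j}=-\beta_{i,j}$ for $i\neq j$. Its Moore–Penrose pseudoinverse is $L^+=(L+\frac1n\mathbf 1\mathbf 1^T)^{-1}-\frac1n\mathbf 1\mathbf 1^T$. $\mathbf 1$ denotes the all-ones vector of the appropriate dimension. $\Sigma_{i,j}=\mathbb{E}[\omega_i\omega_j]$; $\sigma^2=\mathbf 1^T\Sigma\mathbf 1$ is the variance of $\sum_i\omega_i$. A node $i$ has no stochastic load fluctuations if the $i$-th row and column of $\Sigma$ vanish (equivalently $\Sigma_{i,i}=0$); $S=\{i:\Sigma_{i,i}>0\}$ is the set of nodes with stochastic load fluctuations. For $\alpha\in\mathbb{R}^n$ put $C_\alpha:=I-\alpha\mathbf 1^T$, $p(\alpha):=C_\alpha(\mu+\omega)=\mu+C_\alpha\omega$ (the net load profile), $\mathcal H(\alpha):=\frac12p(\alpha)^TL^+p(\alpha)$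 (total loss), and $\mathcal H_s(\alpha):=\mathcal H(\alpha)-\frac12\mu^TL^+\mu$ (total loss due to fluctuations). *)

theory Defs
  imports
    "HOL-Probability.Probability"
    "Jordan_Normal_Form.Gauss_Jordan_Elimination"
begin

unbundle no vec_syntax and no inner_syntax
hide_const (open) Finite_Cartesian_Product.vec
hide_type (open) Finite_Cartesian_Product.vec

text \<open>
  Nodes are numbered from 0, as the matrix library does: the node set is
  \<open>{..<n}\<close> and the first \<open>k\<close> nodes are \<open>{..<k}\<close>.
\<close>

definition ones :: "nat \<Rightarrow> real vec" where
  "ones n = vec n (\<lambda>_. 1)"

definition outer :: "real vec \<Rightarrow> real vec \<Rightarrow> real mat" where
  "outer u v = mat (dim_vec u) (dim_vec v) (\<lambda>(i, j). u $ i * v $ j)"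

text \<open>The value is meaningful for invertible matrices only.\<close>

definition inv_mat :: "real mat \<Rightarrow> real mat" where
  "inv_mat A = the (mat_inverse A)"

text \<open>Only the off-diagonal values of \<open>\<beta>\<close> on \<open>{..<n}\<close> are edge weights; all others are ignored.\<close>

definition weighted_graph :: "nat \<Rightarrow> (nat \<Rightarrow> nat \<Rightarrow> real) \<Rightarrow> bool" where
  "weighted_graph n \<beta> \<longleftrightarrow>
     (\<forall>i<n. \<forall>j<n. i \<noteq> j \<longrightarrow> \<beta> i j = \<beta> j i \<and> \<beta> i j \<ge> 0)"

definition edges :: "nat \<Rightarrow> (nat \<Rightarrow> nat \<Rightarrow> real) \<Rightarrow> (nat \<times> nat) set" where
  "edges n \<beta> = {(i, j). i < n \<and> j < n \<and> i \<noteq> j \<and> \<beta> i j > 0}"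

definition connected_graph :: "nat \<Rightarrow> (nat \<Rightarrow> nat \<Rightarrow> real) \<Rightarrow> bool" where
  "connected_graph n \<beta> \<longleftrightarrow> (\<forall>i<n. \<forall>j<n. (i, j) \<in> (edges n \<beta>)\<^sup>*)"

definition laplacian :: "nat \<Rightarrow> (nat \<Rightarrow> nat \<Rightarrow> real) \<Rightarrow> real mat" where
  "laplacian n \<beta> = mat n n (\<lambda>(i, j).
     if i = j then (\<Sum>l\<in>{..<n} - {i}. \<beta> i l) else - \<beta> i j)"

text \<open>The Moore--Penrose pseudoinverse, by its closed form for the Laplacian of a connected graph.\<close>

definition laplacian_pinv :: "nat \<Rightarrow> (nat \<Rightarrow> nat \<Rightarrow> real) \<Rightarrow> real mat" where
  "laplacian_pinv n \<beta> =
     inv_mat (laplacian n \<beta> + (1 / real n) \<cdot>\<^sub>m outer (ones n) (ones n))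
       - (1 / real n) \<cdot>\<^sub>m outer (ones n) (ones n)"

definition centred_L2_vector :: "'w measure \<Rightarrow> nat \<Rightarrow> ('w \<Rightarrow> real vec) \<Rightarrow> bool" where
  "centred_L2_vector M n \<omega> \<longleftrightarrow>
     (\<forall>x\<in>space M. \<omega> x \<in> carrier_vec n) \<and>
     (\<forall>i<n. (\<lambda>x. \<omega> x $ i) \<in> borel_measurable M \<and>
            integrable M (\<lambda>x. (\<omega> x $ i)\<^sup>2) \<and>
            (LINT x|M. \<omega> x $ i) = 0)"

text \<open>For centred vectors the covariance is the matrix of second moments.\<close>

definition cov_mat :: "'w measure \<Rightarrow> nat \<Rightarrow> ('w \<Rightarrow> real vec) \<Rightarrow> real mat" where
  "cov_mat M n \<omega> = mat n n (\<lambda>(i, j). LINT x|M. \<omega> x $ i * \<omega> x $ j)"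

definition total_variance :: "real mat \<Rightarrow> real" where
  "total_variance \<Sigma> = ones (dim_row \<Sigma>) \<bullet> (\<Sigma> *\<^sub>v ones (dim_col \<Sigma>))"

definition fluctuating_nodes :: "real mat \<Rightarrow> nat set" where
  "fluctuating_nodes \<Sigma> = {i. i < dim_row \<Sigma> \<and> \<Sigma> $$ (i, i) > 0}"

definition net_load :: "nat \<Rightarrow> real vec \<Rightarrow> real vec \<Rightarrow> real vec \<Rightarrow> real vec" where
  "net_load n \<mu> w \<alpha> = (1\<^sub>m n - outer \<alpha> (ones n)) *\<^sub>v (\<mu> + w)"

definition total_loss :: "nat \<Rightarrow> real mat \<Rightarrow> real vec \<Rightarrow> real vec \<Rightarrow> real vec \<Rightarrow> real" where
  "total_loss n Lp \<mu> w \<alpha> =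
     1 / 2 * (net_load n \<mu> w \<alpha> \<bullet> (Lp *\<^sub>v net_load n \<mu> w \<alpha>))"

definition fluctuation_loss :: "nat \<Rightarrow> real mat \<Rightarrow> real vec \<Rightarrow> real vec \<Rightarrow> real vec \<Rightarrow> real" where
  "fluctuation_loss n Lp \<mu> w \<alpha> =
     total_loss n Lp \<mu> w \<alpha> - 1 / 2 * (\<mu> \<bullet> (Lp *\<^sub>v \<mu>))"

definition feasible :: "nat \<Rightarrow> nat \<Rightarrow> real vec \<Rightarrow> bool" where
  "feasible n k \<alpha> \<longleftrightarrow>
     \<alpha> \<in> carrier_vec n \<and> ones n \<bullet> \<alpha> = 1 \<and> (\<forall>v\<in>{..<n} - {..<k}. \<alpha> $ v = 0)"

definition selection_mat :: "nat \<Rightarrow> nat \<Rightarrow> real mat" where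
  "selection_mat n k = mat n k (\<lambda>(i, j). if i = j then 1 else 0)"

end

theory Submission
  imports Defs "Jordan_Normal_Form.Determinant"
begin

text \<open>
  The pseudoinverse \<open>L\<^sup>+\<close> is positive semidefinite with kernel spanned by the all-ones vector. A nonzero
  vector supported on the first \<open>k < n\<close> nodes is not constant, so the leading submatrix \<open>L\<^sub>B\<^sup>+\<close> is positive
  definite. Since \<open>\<mu>\<close> and \<open>\<omega>\<close> are centred, the expected loss at \<open>P a\<close> is, up to a constant, \<open>\<sigma>\<^sup>2\<close> times
  \<open>q(a) = a\<^sup>T L\<^sub>B\<^sup>+ a / 2 - a\<^sup>T b\<close> with \<open>b = P\<^sup>T L\<^sup>+ \<Sigma> 1 / \<sigma>\<^sup>2\<close>. The stated \<open>t\<close> is the stationary point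
  on the hyperplane \<open>1\<^sup>T a = 1\<close>, that is \<open>L\<^sub>B\<^sup>+ t - b\<close> is a multiple of \<open>1\<close>, whence
  \<open>q(a) - q(t) = (a - t)\<^sup>T L\<^sub>B\<^sup>+ (a - t) / 2\<close> there. If all fluctuations occur in \<open>B\<close>, then
  \<open>\<Sigma> 1 / \<sigma>\<^sup>2\<close> is itself feasible and the multiplier vanishes.
\<close>

section \<open>The all-ones vector, rank-one matrices and bilinear forms as double sums\<close>

lemma ones_carrier [simp]: "ones n \<in> carrier_vec n"
  by (simp add: ones_def)

lemma ones_index [simp]: "i < n \<Longrightarrow> ones n $ i = 1"
  by (simp add: ones_def)

lemma dim_ones [simp]: "dim_vec (ones n) = n"
  by (simp add: ones_def)

lemma outer_carrier [simp]:
  "u \<in> carrier_vec n \<Longrightarrow> v \<in> carrier_vec m \<Longrightarrow> outer u v \<in> carrier_mat n m"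
  by (auto simp: outer_def)

lemma ones_scalar_prod: "v \<in> carrier_vec n \<Longrightarrow> ones n \<bullet> v = (\<Sum>i<n. v $ i)"
  by (auto simp: scalar_prod_def atLeast0LessThan intro!: sum.cong)

lemma ones_scalar_prod_ones [simp]: "ones n \<bullet> ones n = real n"
  by (simp add: ones_scalar_prod)

lemma outer_mult_vec:
  assumes "u \<in> carrier_vec n" "v \<in> carrier_vec m" "x \<in> carrier_vec m"
  shows "outer u v *\<^sub>v x = (v \<bullet> x) \<cdot>\<^sub>v u"
proof (rule eq_vecI)
  show "dim_vec (outer u v *\<^sub>v x) = dim_vec ((v \<bullet> x) \<cdot>\<^sub>v u)"
    by (simp add: outer_def)
  fix i assume "i < dim_vec ((v \<bullet> x) \<cdot>\<^sub>v u)"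
  then show "(outer u v *\<^sub>v x) $ i = ((v \<bullet> x) \<cdot>\<^sub>v u) $ i"
    using assms by (auto simp: outer_def scalar_prod_def sum_distrib_right intro!: sum.cong)
qed

lemma smult_mat_mult_vec:
  assumes "A \<in> carrier_mat n m" "x \<in> carrier_vec m"
  shows "(c \<cdot>\<^sub>m A) *\<^sub>v x = c \<cdot>\<^sub>v (A *\<^sub>v x :: real vec)"
  using assms by (intro eq_vecI) (auto simp: scalar_prod_def sum_distrib_left intro!: sum.cong)

text \<open>The entrywise form lets expectations be taken term by term.\<close>

lemma mult_mat_vec_scalar_prod_sum:
  assumes "A \<in> carrier_mat n m" "x \<in> carrier_vec n" "y \<in> carrier_vec m"
  shows "x \<bullet> (A *\<^sub>v y) = (\<Sum>i<n. \<Sum>j<m. A $$ (i, j) * (x $ i * y $ j :: real))"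
  using assms
  by (auto simp: scalar_prod_def sum_distrib_left atLeast0LessThan mult_ac intro!: sum.cong)

section \<open>Positive definite matrices\<close>

text \<open>Symmetry is kept apart: it enters \<open>quadratic_excess\<close> as a separate
  hypothesis, and inverses exist by positivity alone.\<close>

definition pos_def :: "nat \<Rightarrow> real mat \<Rightarrow> bool" where
  "pos_def n A \<longleftrightarrow> A \<in> carrier_mat n n \<and>
     (\<forall>x \<in> carrier_vec n. x \<noteq> 0\<^sub>v n \<longrightarrow> x \<bullet> (A *\<^sub>v x) > 0)"

text \<open>A nonzero kernel vector \<open>v\<close> would give
  \<open>v \<bullet> (A *\<^sub>v v) = 0\<close>, so the determinant is nonzero. Hence
  \<open>mat_inverse\<close> returns \<open>Some\<close>, and the \<open>the\<close> in
  \<open>inv_mat\<close> is well defined.\<close>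

lemma pos_def_inv_mat:
  assumes "pos_def n A"
  shows "inv_mat A \<in> carrier_mat n n" "A * inv_mat A = 1\<^sub>m n" "inv_mat A * A = 1\<^sub>m n"
proof -
  have A: "A \<in> carrier_mat n n" using assms by (simp add: pos_def_def)
  have "Determinant.det A \<noteq> 0"
  proof
    assume "Determinant.det A = 0"
    then obtain v where v: "v \<in> carrier_vec n" "v \<noteq> 0\<^sub>v n" "A *\<^sub>v v = 0\<^sub>v n"
      using det_0_iff_vec_prod_zero[OF A] by blast
    then have "v \<bullet> (A *\<^sub>v v) = 0" by simp
    with v(1,2) assms show False by (auto simp: pos_def_def)
  qed
  then have "A \<in> Units (ring_mat TYPE(real) n n)"
    by (rule det_non_zero_imp_unit[OF A])
  then obtain B where B: "mat_inverse A = Some B"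
    using mat_inverse(1)[OF A, of n] by (cases "mat_inverse A") auto
  show "inv_mat A \<in> carrier_mat n n" "A * inv_mat A = 1\<^sub>m n" "inv_mat A * A = 1\<^sub>m n"
    using mat_inverse(2)[OF A B] B by (auto simp: inv_mat_def)
qed

lemma pos_def_inv_mat_vec:
  assumes "pos_def n A" "x \<in> carrier_vec n"
  shows "inv_mat A *\<^sub>v x \<in> carrier_vec n" "A *\<^sub>v (inv_mat A *\<^sub>v x) = x"
    "inv_mat A *\<^sub>v (A *\<^sub>v x) = x"
proof -
  have A: "A \<in> carrier_mat n n" using assms by (simp add: pos_def_def)
  note I = pos_def_inv_mat[OF assms(1)]
  show "inv_mat A *\<^sub>v x \<in> carrier_vec n" using I(1) assms(2) by simp
  show "A *\<^sub>v (inv_mat A *\<^sub>v x) = x"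
    using assoc_mult_mat_vec[OF A I(1) assms(2)] I(2) assms(2) by simp
  show "inv_mat A *\<^sub>v (A *\<^sub>v x) = x"
    using assoc_mult_mat_vec[OF I(1) A assms(2)] I(3) assms(2) by simp
qed

lemma pos_def_invertible:
  assumes "pos_def n A"
  shows "invertible_mat A"
  using pos_def_inv_mat[OF assms] assms
  by (auto simp: invertible_mat_def inverts_mat_def pos_def_def intro!: exI[of _ "inv_mat A"])

text \<open>Substituting \<open>x = A *\<^sub>v y\<close> turns the form of the inverse at
  \<open>x\<close> into that of \<open>A\<close> at \<open>y\<close>.\<close>

lemma pos_def_inv:
  assumes "pos_def n A"
  shows "pos_def n (inv_mat A)"
  unfolding pos_def_def
proof (intro conjI ballI impI)
  show "inv_mat A \<in> carrier_mat n n" by (rule pos_def_inv_mat(1)[OF assms])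
  fix x :: "real vec" assume x: "x \<in> carrier_vec n" "x \<noteq> 0\<^sub>v n"
  define y where "y = inv_mat A *\<^sub>v x"
  have y: "y \<in> carrier_vec n" "A *\<^sub>v y = x"
    using pos_def_inv_mat_vec[OF assms x(1)] by (auto simp: y_def)
  have A: "A \<in> carrier_mat n n" using assms by (simp add: pos_def_def)
  have "y \<noteq> 0\<^sub>v n" using y x A by auto
  then have "y \<bullet> (A *\<^sub>v y) > 0" using assms y by (auto simp: pos_def_def)
  then show "x \<bullet> (inv_mat A *\<^sub>v x) > 0"
    using y x comm_scalar_prod[of x n y] by (simp add: y_def)
qed

section \<open>The Laplacian and its pseudoinverse\<close>

lemma laplacian_carrier [simp]: "laplacian n \<beta> \<in> carrier_mat n n"
  by (simp add: laplacian_def)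

lemma laplacian_mult_vec_index:
  assumes "x \<in> carrier_vec n" "i < n"
  shows "(laplacian n \<beta> *\<^sub>v x) $ i = (\<Sum>j<n. \<beta> i j * (x $ i - x $ j))"
proof -
  have "(laplacian n \<beta> *\<^sub>v x) $ i
      = (\<Sum>j<n. (if i = j then (\<Sum>l\<in>{..<n} - {i}. \<beta> i l) else - \<beta> i j) * x $ j)"
    using assms by (auto simp: laplacian_def scalar_prod_def atLeast0LessThan intro!: sum.cong)
  also have "\<dots> = (\<Sum>l\<in>{..<n} - {i}. \<beta> i l) * x $ i + (\<Sum>j\<in>{..<n} - {i}. - \<beta> i j * x $ j)"
    using assms(2) by (subst sum.remove[of _ i]) (auto intro!: sum.cong)
  also have "\<dots> = (\<Sum>j\<in>{..<n} - {i}. \<beta> i j * (x $ i - x $ j))"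
    by (simp add: sum_distrib_right sum_subtractf sum_negf right_diff_distrib)
  \<comment> \<open>The index \<open>j = i\<close> can be put back because its difference is zero,
    whatever the value of \<open>\<beta> i i\<close>.\<close>
  also have "\<dots> = (\<Sum>j<n. \<beta> i j * (x $ i - x $ j))"
    using assms(2) by (subst (2) sum.remove[of _ i]) auto
  finally show ?thesis .
qed

text \<open>Averaging the double sum with its copy under exchange of \<open>i\<close> and
  \<open>j\<close> gives the edge-difference form, which makes symmetry, nonnegativity and the
  kernel visible.\<close>

lemma laplacian_bilinear:
  assumes "weighted_graph n \<beta>" "x \<in> carrier_vec n" "y \<in> carrier_vec n"
  shows "x \<bullet> (laplacian n \<beta> *\<^sub>v y)
    = 1 / 2 * (\<Sum>i<n. \<Sum>j<n. \<beta> i j * ((x $ i - x $ j) * (y $ i - y $ j)))"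
proof -
  let ?f = "\<lambda>i j. \<beta> i j * (x $ i * (y $ i - y $ j))"
  have "x \<bullet> (laplacian n \<beta> *\<^sub>v y) = (\<Sum>i<n. x $ i * (laplacian n \<beta> *\<^sub>v y) $ i)"
    using laplacian_carrier[of n \<beta>]
    by (simp add: scalar_prod_def atLeast0LessThan del: laplacian_carrier)
  also have "\<dots> = (\<Sum>i<n. \<Sum>j<n. ?f i j)"
    using assms by (auto simp: laplacian_mult_vec_index sum_distrib_left mult_ac
        simp del: index_mult_mat_vec intro!: sum.cong)
  finally have 1: "x \<bullet> (laplacian n \<beta> *\<^sub>v y) = (\<Sum>i<n. \<Sum>j<n. ?f i j)" .
  have swap: "(\<Sum>i<n. \<Sum>j<n. ?f i j) = (\<Sum>i<n. \<Sum>j<n. ?f j i)"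
    by (rule sum.swap)
  have "?f i j + ?f j i = \<beta> i j * ((x $ i - x $ j) * (y $ i - y $ j))"
    if "i < n" "j < n" for i j
  \<comment> \<open>\<open>weighted_graph\<close> constrains only off-diagonal weights; on the
    diagonal both sides vanish.\<close>
  proof (cases "i = j")
    case False
    then have "\<beta> j i = \<beta> i j" using assms(1) that by (auto simp: weighted_graph_def)
    then show ?thesis by (simp add: algebra_simps)
  qed simp
  then have "(\<Sum>i<n. \<Sum>j<n. ?f i j) + (\<Sum>i<n. \<Sum>j<n. ?f j i)
      = (\<Sum>i<n. \<Sum>j<n. \<beta> i j * ((x $ i - x $ j) * (y $ i - y $ j)))"
    unfolding sum.distrib[symmetric] by (intro sum.cong) auto
  with 1 swap show ?thesis by simp
qed

lemma laplacian_nonneg: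
  assumes "weighted_graph n \<beta>" "x \<in> carrier_vec n"
  shows "x \<bullet> (laplacian n \<beta> *\<^sub>v x) \<ge> 0"
proof -
  have "0 \<le> \<beta> i j * ((x $ i - x $ j) * (x $ i - x $ j))" if "i < n" "j < n" for i j
    using assms(1) that by (cases "i = j") (auto simp: weighted_graph_def)
  then show ?thesis by (auto simp: laplacian_bilinear[OF assms assms(2)] intro!: sum_nonneg)
qed

text \<open>A vanishing sum of nonnegative edge terms has only zero terms, so \<open>x\<close>
  agrees across each edge of positive weight and hence along paths.\<close>

lemma laplacian_eq_0_imp_const:
  assumes "weighted_graph n \<beta>" "connected_graph n \<beta>" "x \<in> carrier_vec n"
    and "x \<bullet> (laplacian n \<beta> *\<^sub>v x) = 0"
  shows "\<exists>c. x = c \<cdot>\<^sub>v ones n"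
proof -
  let ?t = "\<lambda>i j. \<beta> i j * ((x $ i - x $ j) * (x $ i - x $ j))"
  have nn: "0 \<le> ?t i j" if "i < n" "j < n" for i j
    using assms(1) that by (cases "i = j") (auto simp: weighted_graph_def)
  have "(\<Sum>i<n. \<Sum>j<n. ?t i j) = 0"
    using assms(4) by (simp add: laplacian_bilinear[OF assms(1,3,3)])
  then have "\<forall>i\<in>{..<n}. (\<Sum>j<n. ?t i j) = 0"
    by (subst (asm) sum_nonneg_eq_0_iff) (auto intro!: sum_nonneg nn)
  then have t0: "?t i j = 0" if "i < n" "j < n" for i j
    using that nn sum_nonneg_eq_0_iff[of "{..<n}" "?t i"] by auto
  have edge: "x $ i = x $ j" if "(i, j) \<in> edges n \<beta>" for i j
    using t0[of i j] that by (auto simp: edges_def)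
  have path: "x $ i = x $ j" if "(i, j) \<in> (edges n \<beta>)\<^sup>*" for i j
    using that by induction (auto dest: edge)
  \<comment> \<open>Every node is reachable from node 0, whose value serves as the constant; for
    \<open>n = 0\<close> both vectors are empty.\<close>
  have "x = (x $ 0) \<cdot>\<^sub>v ones n"
  proof (rule eq_vecI)
    fix i assume "i < dim_vec ((x $ 0) \<cdot>\<^sub>v ones n)"
    then have "(0, i) \<in> (edges n \<beta>)\<^sup>*" "i < n"
      using assms(2) by (auto simp: connected_graph_def)
    then show "x $ i = ((x $ 0) \<cdot>\<^sub>v ones n) $ i" using path by simp
  qed (use assms(3) in simp)
  then show ?thesis by blast
qed

text \<open>All differences of the all-ones vector are zero.\<close>

lemma ones_laplacian:
  assumes "weighted_graph n \<beta>" "x \<in> carrier_vec n"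
  shows "ones n \<bullet> (laplacian n \<beta> *\<^sub>v x) = 0"
  by (simp add: laplacian_bilinear[OF assms(1) _ assms(2)])

lemma shifted_laplacian_mult_vec:
  assumes "x \<in> carrier_vec n"
  shows "(laplacian n \<beta> + (1 / real n) \<cdot>\<^sub>m outer (ones n) (ones n)) *\<^sub>v x
    = laplacian n \<beta> *\<^sub>v x + ((ones n \<bullet> x) / real n) \<cdot>\<^sub>v ones n"
  using assms
  by (simp add: add_mult_distrib_mat_vec[of _ n n] smult_mat_mult_vec[of _ n n] outer_mult_vec[of _ n _ n]
      smult_smult_assoc)

text \<open>The form splits into two nonnegative parts. If the Laplacian part vanishes then
  \<open>x\<close> is constant, and if the squared sum vanishes too then that constant is
  zero.\<close>

lemma shifted_laplacian_pos_def:
  assumes "weighted_graph n \<beta>" "connected_graph n \<beta>" "n > 0"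
  shows "pos_def n (laplacian n \<beta> + (1 / real n) \<cdot>\<^sub>m outer (ones n) (ones n))"
  unfolding pos_def_def
proof (intro conjI ballI impI)
  fix x :: "real vec" assume x: "x \<in> carrier_vec n" "x \<noteq> 0\<^sub>v n"
  have Lx: "laplacian n \<beta> *\<^sub>v x \<in> carrier_vec n"
    using laplacian_carrier x(1) by (rule mult_mat_vec_carrier)
  have eq: "x \<bullet> ((laplacian n \<beta> + (1 / real n) \<cdot>\<^sub>m outer (ones n) (ones n)) *\<^sub>v x)
      = x \<bullet> (laplacian n \<beta> *\<^sub>v x) + (ones n \<bullet> x)\<^sup>2 / real n"
    using x Lx by (simp add: shifted_laplacian_mult_vec scalar_prod_add_distrib[of _ n]
        comm_scalar_prod[of x n "ones n"] power2_eq_square)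
  have "x \<bullet> (laplacian n \<beta> *\<^sub>v x) + (ones n \<bullet> x)\<^sup>2 / real n \<noteq> 0"
  proof
    assume "x \<bullet> (laplacian n \<beta> *\<^sub>v x) + (ones n \<bullet> x)\<^sup>2 / real n = 0"
    moreover have "(ones n \<bullet> x)\<^sup>2 / real n \<ge> 0" by simp
    ultimately have 0: "x \<bullet> (laplacian n \<beta> *\<^sub>v x) = 0" "(ones n \<bullet> x)\<^sup>2 / real n = 0"
      using laplacian_nonneg[OF assms(1) x(1)] by linarith+
    obtain c where "x = c \<cdot>\<^sub>v ones n"
      using laplacian_eq_0_imp_const[OF assms(1,2) x(1) 0(1)] by blast
    with 0(2) assms(3) have "x = 0 \<cdot>\<^sub>v ones n" by simp
    with x(2) show False by (auto simp: ones_def)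
  qed
  moreover have "(ones n \<bullet> x)\<^sup>2 / real n \<ge> 0" by simp
  ultimately show "x \<bullet> ((laplacian n \<beta> + (1 / real n) \<cdot>\<^sub>m outer (ones n) (ones n)) *\<^sub>v x) > 0"
    unfolding eq using laplacian_nonneg[OF assms(1) x(1)] by linarith
qed simp

lemma laplacian_pinv_carrier:
  assumes "weighted_graph n \<beta>" "connected_graph n \<beta>" "n > 0"
  shows "laplacian_pinv n \<beta> \<in> carrier_mat n n"
  using pos_def_inv_mat(1)[OF shifted_laplacian_pos_def[OF assms]]
  by (simp add: laplacian_pinv_def minus_carrier_mat)

text \<open>Take \<open>y\<close> to be the inverse of the shifted Laplacian applied to
  \<open>x\<close>, and \<open>c\<close> its mean. Since the image of the Laplacian is orthogonal to
  the all-ones vector, \<open>x\<close> and \<open>y\<close> have the same sum, so the rank-one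
  correction subtracts exactly \<open>c\<close> from each entry of \<open>y\<close>.\<close>

lemma laplacian_pinv_preimage:
  assumes "weighted_graph n \<beta>" "connected_graph n \<beta>" "n > 0" "x \<in> carrier_vec n"
  obtains y c where "y \<in> carrier_vec n" "x = laplacian n \<beta> *\<^sub>v y + c \<cdot>\<^sub>v ones n"
    "laplacian_pinv n \<beta> *\<^sub>v x = y - c \<cdot>\<^sub>v ones n" "ones n \<bullet> y = real n * c"
proof -
  let ?A = "laplacian n \<beta> + (1 / real n) \<cdot>\<^sub>m outer (ones n) (ones n)"
  note pd = shifted_laplacian_pos_def[OF assms(1-3)]
  define y where "y = inv_mat ?A *\<^sub>v x"
  have y: "y \<in> carrier_vec n" "?A *\<^sub>v y = x"
    using pos_def_inv_mat_vec[OF pd assms(4)] by (auto simp: y_def)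
  have Ly: "laplacian n \<beta> *\<^sub>v y \<in> carrier_vec n"
    using laplacian_carrier y(1) by (rule mult_mat_vec_carrier)
  have x: "x = laplacian n \<beta> *\<^sub>v y + ((ones n \<bullet> y) / real n) \<cdot>\<^sub>v ones n"
    using shifted_laplacian_mult_vec[OF y(1)] y(2) by simp
  have "ones n \<bullet> x = ones n \<bullet> y"
    using assms(3) Ly by (subst x) (simp add: scalar_prod_add_distrib[of _ n] ones_laplacian[OF assms(1) y(1)])
  then have "laplacian_pinv n \<beta> *\<^sub>v x = y - ((ones n \<bullet> y) / real n) \<cdot>\<^sub>v ones n"
    using assms(4) pos_def_inv_mat(1)[OF pd]
    by (simp add: laplacian_pinv_def minus_mult_distrib_mat_vec[of _ n n] smult_mat_mult_vec[of _ n n]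
        outer_mult_vec[of _ n _ n] smult_smult_assoc y_def)
  with that[OF y(1) x] assms(3) show ?thesis by simp
qed

text \<open>The substitution \<open>x = L y + c 1\<close> transports the bilinear form of the pseudoinverse to that of
  the Laplacian, from which symmetry, nonnegativity and the kernel can be read off.\<close>

lemma laplacian_pinv_bilinear:
  assumes "weighted_graph n \<beta>"
    and "y \<in> carrier_vec n" "x = laplacian n \<beta> *\<^sub>v y + c \<cdot>\<^sub>v ones n"
    and "y' \<in> carrier_vec n" "laplacian_pinv n \<beta> *\<^sub>v x' = y' - c' \<cdot>\<^sub>v ones n"
      "ones n \<bullet> y' = real n * c'"
  shows "x \<bullet> (laplacian_pinv n \<beta> *\<^sub>v x') = y' \<bullet> (laplacian n \<beta> *\<^sub>v y)"
proof -
  have Ly: "laplacian n \<beta> *\<^sub>v y \<in> carrier_vec n"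
    using laplacian_carrier assms(2) by (rule mult_mat_vec_carrier)
  \<comment> \<open>The two terms containing \<open>c\<close> cancel because \<open>c'\<close> is
    the mean of \<open>y'\<close>.\<close>
  have "x \<bullet> (laplacian_pinv n \<beta> *\<^sub>v x')
    = (laplacian n \<beta> *\<^sub>v y) \<bullet> y' - c' * (ones n \<bullet> (laplacian n \<beta> *\<^sub>v y))"
    unfolding assms(3,5) using assms(2,4,6) Ly
    by (simp add: add_scalar_prod_distrib[of _ n] scalar_prod_minus_distrib[of _ n]
        scalar_prod_add_distrib[of _ n] comm_scalar_prod[of _ n "ones n"] algebra_simps)
  then show ?thesis
    using ones_laplacian[OF assms(1,2)] comm_scalar_prod[OF Ly assms(4)] by simp
qed

lemma laplacian_pinv_sym:
  assumes "weighted_graph n \<beta>" "connected_graph n \<beta>" "n > 0"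
    and "x \<in> carrier_vec n" "x' \<in> carrier_vec n"
  shows "x \<bullet> (laplacian_pinv n \<beta> *\<^sub>v x') = x' \<bullet> (laplacian_pinv n \<beta> *\<^sub>v x)"
proof -
  obtain y c where y: "y \<in> carrier_vec n" "x = laplacian n \<beta> *\<^sub>v y + c \<cdot>\<^sub>v ones n"
    "laplacian_pinv n \<beta> *\<^sub>v x = y - c \<cdot>\<^sub>v ones n" "ones n \<bullet> y = real n * c"
    using laplacian_pinv_preimage[OF assms(1-3,4)] by blast
  obtain y' c' where y': "y' \<in> carrier_vec n" "x' = laplacian n \<beta> *\<^sub>v y' + c' \<cdot>\<^sub>v ones n"
    "laplacian_pinv n \<beta> *\<^sub>v x' = y' - c' \<cdot>\<^sub>v ones n" "ones n \<bullet> y' = real n * c'"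
    using laplacian_pinv_preimage[OF assms(1-3,5)] by blast
  show ?thesis
    using laplacian_pinv_bilinear[OF assms(1) y(1,2) y'(1,3,4)]
      laplacian_pinv_bilinear[OF assms(1) y'(1,2) y(1,3,4)]
    by (simp add: laplacian_bilinear[OF assms(1)] y(1) y'(1) mult.commute)
qed

lemma laplacian_pinv_pos:
  assumes "weighted_graph n \<beta>" "connected_graph n \<beta>" "n > 0" "x \<in> carrier_vec n"
    and "\<nexists>c. x = c \<cdot>\<^sub>v ones n"
  shows "x \<bullet> (laplacian_pinv n \<beta> *\<^sub>v x) > 0"
proof -
  obtain y c where y: "y \<in> carrier_vec n" "x = laplacian n \<beta> *\<^sub>v y + c \<cdot>\<^sub>v ones n"
    "laplacian_pinv n \<beta> *\<^sub>v x = y - c \<cdot>\<^sub>v ones n" "ones n \<bullet> y = real n * c"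
    using laplacian_pinv_preimage[OF assms(1-4)] by blast
  have "y \<bullet> (laplacian n \<beta> *\<^sub>v y) \<noteq> 0"
  proof
    assume "y \<bullet> (laplacian n \<beta> *\<^sub>v y) = 0"
    then obtain d where "y = d \<cdot>\<^sub>v ones n"
      using laplacian_eq_0_imp_const[OF assms(1,2) y(1)] by blast
    \<comment> \<open>A constant \<open>y\<close> is annihilated, which leaves \<open>x\<close>
      constant, contrary to assumption.\<close>
    then have "laplacian n \<beta> *\<^sub>v y = 0\<^sub>v n"
      using y(1) laplacian_carrier[of n \<beta>]
      by (intro eq_vecI) (auto simp: laplacian_mult_vec_index simp del: index_mult_mat_vec laplacian_carrier)
    with y(2) have "x = c \<cdot>\<^sub>v ones n" by simp
    with assms(5) show False by blast
  qed
  with laplacian_nonneg[OF assms(1) y(1)]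
    laplacian_pinv_bilinear[OF assms(1) y(1,2) y(1,3,4)]
  show ?thesis by simp
qed

section \<open>Selecting the leading coordinates\<close>

lemma selection_mat_carrier [simp]: "selection_mat n k \<in> carrier_mat n k"
  by (simp add: selection_mat_def)

lemma selection_mult_vec:
  assumes "a \<in> carrier_vec k" "k \<le> n"
  shows "selection_mat n k *\<^sub>v a = a @\<^sub>v 0\<^sub>v (n - k)"
proof (rule eq_vecI)
  fix i assume "i < dim_vec (a @\<^sub>v 0\<^sub>v (n - k))"
  then have "i < n" using assms by simp
  have "(selection_mat n k *\<^sub>v a) $ i = (\<Sum>j<k. (if i = j then 1 else 0) * a $ j)"
    using assms \<open>i < n\<close>
    by (simp add: selection_mat_def scalar_prod_def atLeast0LessThan)
  also have "\<dots> = (\<Sum>j<k. if i = j then a $ j else 0)"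
    by (rule sum.cong) auto
  finally show "(selection_mat n k *\<^sub>v a) $ i = (a @\<^sub>v 0\<^sub>v (n - k)) $ i"
    using assms \<open>i < n\<close> by auto
qed (use assms in \<open>auto simp: selection_mat_def\<close>)

lemma transpose_selection_mult_vec:
  assumes "x \<in> carrier_vec n" "k \<le> n"
  shows "transpose_mat (selection_mat n k) *\<^sub>v x = vec k (($) x)"
proof (rule eq_vecI)
  fix i assume "i < dim_vec (vec k (($) x))"
  then have "i < k" by simp
  have "(transpose_mat (selection_mat n k) *\<^sub>v x) $ i = (\<Sum>j<n. (if j = i then 1 else 0) * x $ j)"
    using assms \<open>i < k\<close>
    by (simp add: selection_mat_def scalar_prod_def atLeast0LessThan)
  also have "\<dots> = (\<Sum>j<n. if j = i then x $ j else 0)"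
    by (rule sum.cong) auto
  finally show "(transpose_mat (selection_mat n k) *\<^sub>v x) $ i = vec k (($) x) $ i"
    using assms \<open>i < k\<close> by auto
qed (simp add: selection_mat_def)

lemma transpose_selection_mult_ones:
  "k \<le> n \<Longrightarrow> transpose_mat (selection_mat n k) *\<^sub>v ones n = ones k"
  by (subst transpose_selection_mult_vec[of _ n]) auto

lemma selection_mult_transpose_selection:
  assumes "x \<in> carrier_vec n" "k \<le> n" "\<forall>v\<in>{..<n} - {..<k}. x $ v = 0"
  shows "selection_mat n k *\<^sub>v (transpose_mat (selection_mat n k) *\<^sub>v x) = x"
proof -
  have "vec k (($) x) @\<^sub>v 0\<^sub>v (n - k) = x"
    using assms by (intro eq_vecI) auto
  then show ?thesis
    using assms by (simp add: transpose_selection_mult_vec selection_mult_vec)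
qed

text \<open>This turns the constrained problem in \<open>n\<close> variables into one on the
  hyperplane of sum 1 in \<open>k\<close> variables.\<close>

lemma feasible_iff:
  assumes "k \<le> n"
  shows "feasible n k \<alpha> \<longleftrightarrow>
    (\<exists>a \<in> carrier_vec k. ones k \<bullet> a = 1 \<and> \<alpha> = selection_mat n k *\<^sub>v a)"
proof -
  let ?P = "selection_mat n k"
  \<comment> \<open>Padding with zeros preserves the sum, as the transpose sends the all-ones vector
    to the all-ones vector.\<close>
  have sum: "ones n \<bullet> (?P *\<^sub>v a) = ones k \<bullet> a" if "a \<in> carrier_vec k" for a
    using transpose_vec_mult_scalar[of ?P n k a "ones n"] that
    by (simp add: transpose_selection_mult_ones[OF assms])
  show ?thesis
  proof
    assume f: "feasible n k \<alpha>"
    let ?a = "transpose_mat ?P *\<^sub>v \<alpha>"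
    have "?a \<in> carrier_vec k" using f by (auto simp: feasible_def intro!: mult_mat_vec_carrier[of _ k n])
    moreover have "\<alpha> = ?P *\<^sub>v ?a"
      using f assms by (simp add: feasible_def selection_mult_transpose_selection)
    ultimately show "\<exists>a \<in> carrier_vec k. ones k \<bullet> a = 1 \<and> \<alpha> = ?P *\<^sub>v a"
      using sum[of ?a] f by (auto simp: feasible_def)
  next
    assume "\<exists>a \<in> carrier_vec k. ones k \<bullet> a = 1 \<and> \<alpha> = ?P *\<^sub>v a"
    then obtain a where a: "a \<in> carrier_vec k" "ones k \<bullet> a = 1" "\<alpha> = ?P *\<^sub>v a" by blast
    have "\<alpha> \<in> carrier_vec n" unfolding a(3) using selection_mat_carrier a(1) by (rule mult_mat_vec_carrier)
    moreover have "\<forall>v\<in>{..<n} - {..<k}. \<alpha> $ v = 0"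
      using a(1) assms by (auto simp: a(3) selection_mult_vec)
    ultimately show "feasible n k \<alpha>"
      using sum[OF a(1)] a by (simp add: feasible_def)
  qed
qed

lemma principal_submatrix_mult_vec:
  assumes "A \<in> carrier_mat n n" "P \<in> carrier_mat n k" "a \<in> carrier_vec k"
  shows "(transpose_mat P * A * P) *\<^sub>v a = transpose_mat P *\<^sub>v (A *\<^sub>v (P *\<^sub>v (a :: real vec)))"
  using assms
  by (simp add: assoc_mult_mat_vec[of _ k n _ k] assoc_mult_mat_vec[of _ k n _ n])

lemma laplacian_pinv_submatrix_pos_def:
  assumes "weighted_graph n \<beta>" "connected_graph n \<beta>" "k < n"
  shows "pos_def k (transpose_mat (selection_mat n k) * laplacian_pinv n \<beta> * selection_mat n k)"
  unfolding pos_def_def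
proof (intro conjI ballI impI)
  let ?P = "selection_mat n k" and ?Lp = "laplacian_pinv n \<beta>"
  have Lp: "?Lp \<in> carrier_mat n n" using assms by (intro laplacian_pinv_carrier) auto
  show "transpose_mat ?P * ?Lp * ?P \<in> carrier_mat k k"
    using Lp by (intro mult_carrier_mat[of _ _ n]) auto
  fix a :: "real vec" assume a: "a \<in> carrier_vec k" "a \<noteq> 0\<^sub>v k"
  have Pa: "?P *\<^sub>v a \<in> carrier_vec n"
    using selection_mat_carrier a(1) by (rule mult_mat_vec_carrier)
  then have LPa: "?Lp *\<^sub>v (?P *\<^sub>v a) \<in> carrier_vec n"
    using Lp by simp
  have "\<nexists>c. ?P *\<^sub>v a = c \<cdot>\<^sub>v ones n"
  proof
    assume "\<exists>c. ?P *\<^sub>v a = c \<cdot>\<^sub>v ones n"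
    then obtain c where c: "a @\<^sub>v 0\<^sub>v (n - k) = c \<cdot>\<^sub>v ones n"
      using a(1) assms(3) by (auto simp: selection_mult_vec)
    have "(a @\<^sub>v 0\<^sub>v (n - k)) $ i = c" if "i < n" for i
      unfolding c using that by simp
    note ind = this
    \<comment> \<open>With numbering from 0, node \<open>k\<close> is the first one outside the
      selection; it exists since \<open>k < n\<close>, and the padded vector is zero there.\<close>
    have "c = 0" using ind[of k] a(1) assms(3) by simp
    then have "a = 0\<^sub>v k"
    proof (intro eq_vecI)
      fix i assume "i < dim_vec (0\<^sub>v k :: real vec)"
      then show "a $ i = 0\<^sub>v k $ i" using ind[of i] a(1) assms(3) \<open>c = 0\<close> by simp
    qed (use a in simp)
    with a(2) show False by simp
  qed
  with assms Pa have "(?P *\<^sub>v a) \<bullet> (?Lp *\<^sub>v (?P *\<^sub>v a)) > 0"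
    by (intro laplacian_pinv_pos) auto
  also have "(?P *\<^sub>v a) \<bullet> (?Lp *\<^sub>v (?P *\<^sub>v a)) = a \<bullet> (transpose_mat ?P *\<^sub>v (?Lp *\<^sub>v (?P *\<^sub>v a)))"
    using transpose_vec_mult_scalar[OF selection_mat_carrier a(1) LPa] Pa LPa a(1)
    by (subst (1 2) comm_scalar_prod[of _ n] comm_scalar_prod[of _ k])
      (auto intro!: mult_mat_vec_carrier[of _ k n])
  finally show "a \<bullet> ((transpose_mat ?P * ?Lp * ?P) *\<^sub>v a) > 0"
    using principal_submatrix_mult_vec[OF Lp selection_mat_carrier a(1)] by simp
qed

section \<open>The expected loss\<close>

text \<open>The product is dominated by the sum of the squares.\<close>

lemma integrable_mult_of_squares:
  fixes f g :: "'w \<Rightarrow> real"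
  assumes "f \<in> borel_measurable M" "g \<in> borel_measurable M"
    and "integrable M (\<lambda>x. (f x)\<^sup>2)" "integrable M (\<lambda>x. (g x)\<^sup>2)"
  shows "integrable M (\<lambda>x. f x * g x)"
proof (rule Bochner_Integration.integrable_bound)
  show "integrable M (\<lambda>x. (f x)\<^sup>2 + (g x)\<^sup>2)" using assms by simp
  have "\<bar>a * b\<bar> \<le> a\<^sup>2 + b\<^sup>2" for a b :: real
  proof -
    have "2 * \<bar>a * b\<bar> \<le> a\<^sup>2 + b\<^sup>2"
      using sum_squares_bound[of "\<bar>a\<bar>" "\<bar>b\<bar>"] by (simp add: abs_mult)
    then show ?thesis using abs_ge_zero[of "a * b"] by linarith
  qed
  then show "AE x in M. norm (f x * g x) \<le> norm ((f x)\<^sup>2 + (g x)\<^sup>2)" by auto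
qed (use assms in measurable)

lemma cov_mat_carrier [simp]: "cov_mat M n \<omega> \<in> carrier_mat n n"
  by (simp add: cov_mat_def)

lemma cov_mat_mult_ones_index:
  "i < n \<Longrightarrow> (cov_mat M n \<omega> *\<^sub>v ones n) $ i = (\<Sum>j<n. LINT x|M. \<omega> x $ i * \<omega> x $ j)"
  by (auto simp: cov_mat_def scalar_prod_def atLeast0LessThan intro!: sum.cong)

lemma cov_mat_mult_ones_carrier [simp]: "cov_mat M n \<omega> *\<^sub>v ones n \<in> carrier_vec n"
  using cov_mat_carrier ones_carrier by (rule mult_mat_vec_carrier)

lemma total_variance_cov_mat:
  "total_variance (cov_mat M n \<omega>) = ones n \<bullet> (cov_mat M n \<omega> *\<^sub>v ones n)"
  by (simp add: total_variance_def cov_mat_def)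

text \<open>Since \<mu> sums to zero, the balancing term only redistributes the total of
  \<open>w\<close>.\<close>

lemma net_load_index:
  assumes "\<mu> \<in> carrier_vec n" "ones n \<bullet> \<mu> = 0" "w \<in> carrier_vec n" "\<alpha> \<in> carrier_vec n" "i < n"
  shows "net_load n \<mu> w \<alpha> $ i = \<mu> $ i + (w $ i - \<alpha> $ i * (\<Sum>j<n. w $ j))"
proof -
  have "net_load n \<mu> w \<alpha> = (\<mu> + w) - (ones n \<bullet> (\<mu> + w)) \<cdot>\<^sub>v \<alpha>"
    using assms by (simp add: net_load_def minus_mult_distrib_mat_vec[of _ n n] outer_mult_vec[of _ n _ n])
  with assms show ?thesis
    by (simp add: scalar_prod_add_distrib[of _ n] ones_scalar_prod[of w])
qed

lemma net_load_carrier: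
  assumes "\<mu> \<in> carrier_vec n" "w \<in> carrier_vec n" "\<alpha> \<in> carrier_vec n"
  shows "net_load n \<mu> w \<alpha> \<in> carrier_vec n"
  using assms unfolding net_load_def
  by (intro mult_mat_vec_carrier[of _ n n]) (auto intro!: minus_carrier_mat)

text \<open>The net load is \<mu> plus a balanced fluctuation of mean zero. The pure \<mu> part
  cancels, mixed terms average out, and second moments remain. Since \<open>A\<close> is an
  arbitrary square matrix, two separate cross terms appear; the first double sum does not involve
  \<alpha>.\<close>

lemma expected_fluctuation_loss:
  assumes "prob_space M" "centred_L2_vector M n \<omega>" "\<mu> \<in> carrier_vec n" "ones n \<bullet> \<mu> = 0"
    and "A \<in> carrier_mat n n" "\<alpha> \<in> carrier_vec n"
  defines "\<Sigma> \<equiv> cov_mat M n \<omega>"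
  defines "r \<equiv> \<Sigma> *\<^sub>v ones n"
  shows "(LINT x|M. fluctuation_loss n A \<mu> (\<omega> x) \<alpha>)
    = 1 / 2 * (\<Sum>i<n. \<Sum>j<n. A $$ (i, j) * \<Sigma> $$ (i, j))
      + 1 / 2 * (total_variance \<Sigma> * (\<alpha> \<bullet> (A *\<^sub>v \<alpha>)) - \<alpha> \<bullet> (A *\<^sub>v r) - r \<bullet> (A *\<^sub>v \<alpha>))"
proof -
  interpret prob_space M by fact
  define w where "w i x = \<omega> x $ i" for i x
  \<comment> \<open>\<open>s\<close> is the total fluctuation and \<open>u\<close> the fluctuation
    left after node \<open>i\<close> absorbs its share \<open>\<alpha> $ i\<close> of it.\<close>
  define s where "s x = (\<Sum>l<n. w l x)" for x
  define u where "u i x = w i x - \<alpha> $ i * s x" for i x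
  let ?V = "total_variance \<Sigma>"
  have wm: "w i \<in> borel_measurable M" and w2: "integrable M (\<lambda>x. (w i x)\<^sup>2)"
    and w0: "(LINT x|M. w i x) = 0" if "i < n" for i
    using assms(2) that by (auto simp: centred_L2_vector_def w_def[abs_def])
  have \<omega>: "\<omega> x \<in> carrier_vec n" if "x \<in> space M" for x
    using assms(2) that by (auto simp: centred_L2_vector_def)
  have r: "r \<in> carrier_vec n" by (simp add: r_def \<Sigma>_def)
  \<comment> \<open>\<open>has_bochner_integral\<close> carries integrability together with the
    value. First moments exist because the measure is finite.\<close>
  have hw: "has_bochner_integral M (w i) 0" if "i < n" for i
    using square_integrable_imp_integrable[OF wm w2] w0 that by (simp add: has_bochner_integral_iff)
  have hww: "has_bochner_integral M (\<lambda>x. w i x * w j x) (\<Sigma> $$ (i, j))" if "i < n" "j < n" for i j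
    using integrable_mult_of_squares[OF wm wm w2 w2] that
    by (simp add: has_bochner_integral_iff \<Sigma>_def cov_mat_def w_def)
  have ri: "r $ i = (\<Sum>j<n. \<Sigma> $$ (i, j))" if "i < n" for i
    using that unfolding r_def \<Sigma>_def by (subst cov_mat_mult_ones_index) (auto simp: cov_mat_def)
  have hs: "has_bochner_integral M s 0"
    using has_bochner_integral_sum[of "{..<n}" M w "\<lambda>_. 0"] hw by (simp add: s_def[abs_def])
  \<comment> \<open>Thus \<open>r $ i\<close> is the covariance of \<open>w i\<close> with the total
    \<open>s\<close>.\<close>
  have hws: "has_bochner_integral M (\<lambda>x. w i x * s x) (r $ i)" if "i < n" for i
    unfolding s_def sum_distrib_left ri[OF that] using that by (intro has_bochner_integral_sum hww) auto
  have hss: "has_bochner_integral M (\<lambda>x. s x * s x) ?V"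
  proof -
    have "?V = (\<Sum>i<n. r $ i)"
      using r by (simp add: \<Sigma>_def total_variance_cov_mat r_def ones_scalar_prod)
    moreover have "has_bochner_integral M (\<lambda>x. \<Sum>i<n. w i x * s x) (\<Sum>i<n. r $ i)"
      by (intro has_bochner_integral_sum hws) auto
    moreover have "(\<lambda>x. \<Sum>i<n. w i x * s x) = (\<lambda>x. s x * s x)"
      by (simp add: s_def sum_distrib_right)
    ultimately show ?thesis by simp
  qed
  have hu: "has_bochner_integral M (u i) 0" if "i < n" for i
    using has_bochner_integral_diff[OF hw[OF that] has_bochner_integral_mult_right[OF hs, of "\<alpha> $ i"]]
    by (simp add: u_def[abs_def])
  have huu: "has_bochner_integral M (\<lambda>x. u i x * u j x)
      (\<Sigma> $$ (i, j) - \<alpha> $ j * r $ i - \<alpha> $ i * r $ j + \<alpha> $ i * \<alpha> $ j * ?V)"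
    if "i < n" "j < n" for i j
  proof -
    have "has_bochner_integral M
        (\<lambda>x. w i x * w j x - \<alpha> $ j * (w i x * s x) - \<alpha> $ i * (w j x * s x) + \<alpha> $ i * \<alpha> $ j * (s x * s x))
        (\<Sigma> $$ (i, j) - \<alpha> $ j * r $ i - \<alpha> $ i * r $ j + \<alpha> $ i * \<alpha> $ j * ?V)"
      using that
      by (intro has_bochner_integral_add has_bochner_integral_diff has_bochner_integral_mult_right
          hww hws hss)
    moreover have "(\<lambda>x. w i x * w j x - \<alpha> $ j * (w i x * s x) - \<alpha> $ i * (w j x * s x)
        + \<alpha> $ i * \<alpha> $ j * (s x * s x)) = (\<lambda>x. u i x * u j x)"
      by (simp add: u_def algebra_simps)
    ultimately show ?thesis by simp
  qed
  have loss: "fluctuation_loss n A \<mu> (\<omega> x) \<alpha> = (\<Sum>i<n. \<Sum>j<n. 1 / 2 * A $$ (i, j)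
      * (\<mu> $ i * u j x + \<mu> $ j * u i x + u i x * u j x))" if "x \<in> space M" for x
  proof -
    note nl = net_load_carrier[OF assms(3) \<omega>[OF that] assms(6)]
    have "fluctuation_loss n A \<mu> (\<omega> x) \<alpha> = 1 / 2 * (\<Sum>i<n. \<Sum>j<n. A $$ (i, j)
        * (net_load n \<mu> (\<omega> x) \<alpha> $ i * net_load n \<mu> (\<omega> x) \<alpha> $ j - \<mu> $ i * \<mu> $ j))"
      using mult_mat_vec_scalar_prod_sum[OF assms(5) nl nl]
        mult_mat_vec_scalar_prod_sum[OF assms(5,3,3)]
      by (simp add: fluctuation_loss_def total_loss_def right_diff_distrib sum_subtractf)
    also have "\<dots> = 1 / 2 * (\<Sum>i<n. \<Sum>j<n. A $$ (i, j)
        * (\<mu> $ i * u j x + \<mu> $ j * u i x + u i x * u j x))"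
      by (intro arg_cong[where f = "\<lambda>t. 1 / 2 * t"] sum.cong refl)
        (simp add: net_load_index[OF assms(3,4) \<omega>[OF that] assms(6)] u_def s_def w_def algebra_simps)
    finally show ?thesis by (simp add: sum_distrib_left mult.assoc)
  qed
  have "has_bochner_integral M (\<lambda>x. \<Sum>i<n. \<Sum>j<n. 1 / 2 * A $$ (i, j)
      * (\<mu> $ i * u j x + \<mu> $ j * u i x + u i x * u j x))
    (\<Sum>i<n. \<Sum>j<n. 1 / 2 * A $$ (i, j)
      * (\<mu> $ i * 0 + \<mu> $ j * 0 + (\<Sigma> $$ (i, j) - \<alpha> $ j * r $ i - \<alpha> $ i * r $ j + \<alpha> $ i * \<alpha> $ j * ?V)))"
    by (intro has_bochner_integral_sum has_bochner_integral_mult_right has_bochner_integral_add hu huu) auto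
  then have "(LINT x|M. fluctuation_loss n A \<mu> (\<omega> x) \<alpha>) = (\<Sum>i<n. \<Sum>j<n. 1 / 2 * A $$ (i, j)
      * (\<mu> $ i * 0 + \<mu> $ j * 0 + (\<Sigma> $$ (i, j) - \<alpha> $ j * r $ i - \<alpha> $ i * r $ j + \<alpha> $ i * \<alpha> $ j * ?V)))"
    \<comment> \<open>The pointwise formula is available only on \<open>space M\<close>, which
      suffices for the integral.\<close>
    using loss by (subst Bochner_Integration.integral_cong[OF refl loss])
      (auto dest: has_bochner_integral_integral_eq)
  then show ?thesis
    by (simp add: mult_mat_vec_scalar_prod_sum[OF assms(5,6,6)] mult_mat_vec_scalar_prod_sum[OF assms(5,6) r]
        mult_mat_vec_scalar_prod_sum[OF assms(5) r assms(6)] sum_distrib_left sum.distrib sum_subtractf algebra_simps)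
qed

text \<open>A nonpositive second moment forces the component to vanish almost everywhere, which
  kills its whole row of the covariance matrix.\<close>

lemma cov_mat_mult_ones_eq_0:
  assumes "centred_L2_vector M n \<omega>" "i < n" "i \<notin> fluctuating_nodes (cov_mat M n \<omega>)"
  shows "(cov_mat M n \<omega> *\<^sub>v ones n) $ i = 0"
proof -
  have int: "integrable M (\<lambda>x. (\<omega> x $ i)\<^sup>2)"
    using assms by (auto simp: centred_L2_vector_def)
  have "(LINT x|M. (\<omega> x $ i)\<^sup>2) \<le> 0"
    using assms by (simp add: fluctuating_nodes_def cov_mat_def power2_eq_square)
  moreover have "(LINT x|M. (\<omega> x $ i)\<^sup>2) \<ge> 0" by simp
  ultimately have "(LINT x|M. (\<omega> x $ i)\<^sup>2) = 0" by linarith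
  then have "AE x in M. (\<omega> x $ i)\<^sup>2 = 0"
    using integral_nonneg_eq_0_iff_AE[OF int] by simp
  then have "(LINT x|M. \<omega> x $ i * \<omega> x $ j) = 0" for j
    by (intro integral_eq_zero_AE) auto
  then show ?thesis by (simp add: cov_mat_mult_ones_index[OF assms(2)])
qed

section \<open>Quadratic minimization under a sum constraint\<close>

text \<open>Regrouped, \<open>t\<close> is the solution \<open>v\<close> of
  \<open>Q *\<^sub>v v = b\<close> plus the multiple of \<open>h\<close> that corrects the sum to 1.
  As \<open>Q\<close> maps \<open>h\<close> to the all-ones vector, that multiple is the Lagrange
  multiplier.\<close>

lemma stationary_point:
  assumes "pos_def k Q" "k > 0" "b \<in> carrier_vec k"
  defines "h \<equiv> inv_mat Q *\<^sub>v ones k"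
  defines "\<tau> \<equiv> ones k \<bullet> h"
  defines "t \<equiv> (1 / \<tau>) \<cdot>\<^sub>v h + (1\<^sub>m k - (1 / \<tau>) \<cdot>\<^sub>m outer h (ones k)) *\<^sub>v (inv_mat Q *\<^sub>v b)"
  shows "\<tau> > 0"
    and "t = inv_mat Q *\<^sub>v b + ((1 - ones k \<bullet> (inv_mat Q *\<^sub>v b)) / \<tau>) \<cdot>\<^sub>v h"
    and "ones k \<bullet> t = 1"
    and "Q *\<^sub>v t = b + ((1 - ones k \<bullet> (inv_mat Q *\<^sub>v b)) / \<tau>) \<cdot>\<^sub>v ones k"
proof -
  have Q: "Q \<in> carrier_mat k k" using assms(1) by (simp add: pos_def_def)
  note inv = pos_def_inv_mat_vec[OF assms(1)]
  have h: "h \<in> carrier_vec k" "Q *\<^sub>v h = ones k" using inv by (simp_all add: h_def)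
  define v where "v = inv_mat Q *\<^sub>v b"
  have v: "v \<in> carrier_vec k" "Q *\<^sub>v v = b" using inv assms(3) by (simp_all add: v_def)
  \<comment> \<open>The condition \<open>k > 0\<close> makes the all-ones vector nonzero, so
    positivity of the inverse applies to it.\<close>
  have "ones k $ 0 \<noteq> (0\<^sub>v k :: real vec) $ 0" using assms(2) by simp
  then have "ones k \<noteq> 0\<^sub>v k" by metis
  then show \<tau>: "\<tau> > 0"
    using pos_def_inv[OF assms(1)] by (simp add: pos_def_def \<tau>_def h_def)
  have "t = (1 / \<tau>) \<cdot>\<^sub>v h + (v - (1 / \<tau>) \<cdot>\<^sub>v ((ones k \<bullet> v) \<cdot>\<^sub>v h))"
    unfolding t_def v_def[symmetric] using h v
    by (simp add: minus_mult_distrib_mat_vec[of _ k k] smult_mat_mult_vec[of _ k k] outer_mult_vec[of _ k _ k])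
  also have "\<dots> = v + ((1 - ones k \<bullet> v) / \<tau>) \<cdot>\<^sub>v h"
    using h v \<tau> by (intro eq_vecI) (auto simp: field_simps)
  finally show t: "t = inv_mat Q *\<^sub>v b + ((1 - ones k \<bullet> (inv_mat Q *\<^sub>v b)) / \<tau>) \<cdot>\<^sub>v h"
    by (simp add: v_def)
  show "ones k \<bullet> t = 1"
    unfolding t v_def[symmetric] using h v \<tau>
    by (simp add: scalar_prod_add_distrib[of _ k] \<tau>_def[symmetric])
  show "Q *\<^sub>v t = b + ((1 - ones k \<bullet> (inv_mat Q *\<^sub>v b)) / \<tau>) \<cdot>\<^sub>v ones k"
    unfolding t v_def[symmetric] using h v Q
    by (simp add: mult_add_distrib_mat_vec[of _ k k] mult_mat_vec[of _ k k])
qed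

text \<open>This is completion of the square at \<open>t\<close>: on the hyperplane, stationarity
  removes the part linear in \<open>a - t\<close>.\<close>

lemma quadratic_excess:
  assumes "Q \<in> carrier_mat k k"
    and sym: "\<And>x y. x \<in> carrier_vec k \<Longrightarrow> y \<in> carrier_vec k \<Longrightarrow> x \<bullet> (Q *\<^sub>v y) = y \<bullet> (Q *\<^sub>v x)"
    and "a \<in> carrier_vec k" "t \<in> carrier_vec k" "b \<in> carrier_vec k"
    and "ones k \<bullet> a = 1" "ones k \<bullet> t = 1" "Q *\<^sub>v t = b + c \<cdot>\<^sub>v ones k"
  shows "1 / 2 * (a \<bullet> (Q *\<^sub>v a)) - a \<bullet> b
    = 1 / 2 * (t \<bullet> (Q *\<^sub>v t)) - t \<bullet> b + 1 / 2 * ((a - t) \<bullet> (Q *\<^sub>v (a - t)))"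
proof -
  \<comment> \<open>The multiplier contributes the same \<open>c\<close> at every point of the
    hyperplane, so it cancels between \<open>a\<close> and \<open>t\<close>.\<close>
  have *: "x \<bullet> (Q *\<^sub>v t) = x \<bullet> b + c" if "x \<in> carrier_vec k" "ones k \<bullet> x = 1" for x
    using that assms(5) comm_scalar_prod[of x k "ones k"]
    by (simp add: assms(8) scalar_prod_add_distrib[of _ k])
  have Qa: "Q *\<^sub>v a \<in> carrier_vec k" "Q *\<^sub>v t \<in> carrier_vec k"
    using assms(1,3,4) by auto
  have "(a - t) \<bullet> (Q *\<^sub>v (a - t)) = a \<bullet> (Q *\<^sub>v a) - 2 * (a \<bullet> (Q *\<^sub>v t)) + t \<bullet> (Q *\<^sub>v t)"
    using assms(1,3,4) Qa sym[OF assms(4,3)]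
    by (simp add: mult_minus_distrib_mat_vec[of _ k k] minus_scalar_prod_distrib[of _ k]
        scalar_prod_minus_distrib[of _ k])
  then show ?thesis using *[OF assms(3,6)] *[OF assms(4,7)] by (simp add: field_simps)
qed

section \<open>The optimal allocation over the first \<open>k\<close> nodes\<close>

theorem theorem4:
  fixes n k :: nat
    and \<beta> :: "nat \<Rightarrow> nat \<Rightarrow> real"
    and \<mu> :: "real vec"
    and M :: "'w measure"
    and \<omega> :: "'w \<Rightarrow> real vec"
  assumes "weighted_graph n \<beta>" and "connected_graph n \<beta>"
    and "\<mu> \<in> carrier_vec n" and "ones n \<bullet> \<mu> = 0"
    and "prob_space M" and "centred_L2_vector M n \<omega>"
    and "total_variance (cov_mat M n \<omega>) > 0"
    and "1 \<le> k" and "k < n"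
  shows
    "let Lp = laplacian_pinv n \<beta>;
         \<Sigma> = cov_mat M n \<omega>;
         \<sigma>2 = total_variance \<Sigma>;
         P = selection_mat n k;
         LB = transpose_mat P * Lp * P;
         LBi = inv_mat LB;
         tB = ones k \<bullet> (LBi *\<^sub>v ones k);
         \<alpha>t = (1 / tB) \<cdot>\<^sub>v (LBi *\<^sub>v ones k)
            + (1\<^sub>m k - (1 / tB) \<cdot>\<^sub>m outer (LBi *\<^sub>v ones k) (ones k))
                *\<^sub>v (LBi *\<^sub>v (transpose_mat P *\<^sub>v (Lp *\<^sub>v ((1 / \<sigma>2) \<cdot>\<^sub>v (\<Sigma> *\<^sub>v ones n)))));
         \<alpha>s = P *\<^sub>v \<alpha>t;
         S = fluctuating_nodes \<Sigma>;
         B = {..<k}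
     in invertible_mat LB \<and> tB > 0
        \<and> \<alpha>s = \<alpha>t @\<^sub>v 0\<^sub>v (n - k)
        \<and> (\<forall>\<alpha>. is_arg_min (\<lambda>\<alpha>. LINT x|M. fluctuation_loss n Lp \<mu> (\<omega> x) \<alpha>) (feasible n k) \<alpha>
               \<longleftrightarrow> \<alpha> = \<alpha>s)
        \<and> (S \<subseteq> B \<longrightarrow>
             \<alpha>t = transpose_mat P *\<^sub>v ((1 / \<sigma>2) \<cdot>\<^sub>v (\<Sigma> *\<^sub>v ones n))
             \<and> \<alpha>s = (1 / \<sigma>2) \<cdot>\<^sub>v (\<Sigma> *\<^sub>v ones n)
             \<and> (\<forall>v\<in>B - S. \<alpha>t $ v = 0))"
proof -
  define Lp where "Lp = laplacian_pinv n \<beta>"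
  define \<Sigma> where "\<Sigma> = cov_mat M n \<omega>"
  define \<sigma>2 where "\<sigma>2 = total_variance \<Sigma>"
  define P where "P = selection_mat n k"
  define LB where "LB = transpose_mat P * Lp * P"
  define LBi where "LBi = inv_mat LB"
  define tB where "tB = ones k \<bullet> (LBi *\<^sub>v ones k)"
  define g where "g = (1 / \<sigma>2) \<cdot>\<^sub>v (\<Sigma> *\<^sub>v ones n)"
  define b where "b = transpose_mat P *\<^sub>v (Lp *\<^sub>v g)"
  define \<alpha>t where "\<alpha>t = (1 / tB) \<cdot>\<^sub>v (LBi *\<^sub>v ones k)
    + (1\<^sub>m k - (1 / tB) \<cdot>\<^sub>m outer (LBi *\<^sub>v ones k) (ones k)) *\<^sub>v (LBi *\<^sub>v b)"
  \<comment> \<open>\<kappa> is the Lagrange multiplier of the sum constraint and \<open>q\<close>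
    below is the reduced objective.\<close>
  define \<kappa> where "\<kappa> = (1 - ones k \<bullet> (LBi *\<^sub>v b)) / tB"
  define F where "F \<alpha> = (LINT x|M. fluctuation_loss n Lp \<mu> (\<omega> x) \<alpha>)" for \<alpha>
  define q where "q a = 1 / 2 * (a \<bullet> (LB *\<^sub>v a)) - a \<bullet> b" for a
  have n: "n > 0" and kn: "k \<le> n" and k: "k > 0" using assms by auto
  have \<sigma>2: "\<sigma>2 > 0" using assms(7) by (simp add: \<sigma>2_def \<Sigma>_def)
  have Lp: "Lp \<in> carrier_mat n n"
    unfolding Lp_def by (rule laplacian_pinv_carrier[OF assms(1,2) n])
  have P: "P \<in> carrier_mat n k" by (simp add: P_def)
  have PT: "transpose_mat P \<in> carrier_mat k n" using P by simp
  have r: "\<Sigma> *\<^sub>v ones n \<in> carrier_vec n" by (simp add: \<Sigma>_def)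
  have g: "g \<in> carrier_vec n" using r by (simp add: g_def)
  have Lpv: "Lp *\<^sub>v x \<in> carrier_vec n" if "x \<in> carrier_vec n" for x using Lp that by simp
  have Pv: "P *\<^sub>v a \<in> carrier_vec n" if "a \<in> carrier_vec k" for a using P that by simp
  have PTv: "transpose_mat P *\<^sub>v x \<in> carrier_vec k" if "x \<in> carrier_vec n" for x using PT that by simp
  have b: "b \<in> carrier_vec k" unfolding b_def by (intro PTv Lpv g)
  have pd: "pos_def k LB"
    unfolding LB_def P_def Lp_def by (rule laplacian_pinv_submatrix_pos_def[OF assms(1,2,9)])
  then have LB: "LB \<in> carrier_mat k k" by (simp add: pos_def_def)
  have adj: "(P *\<^sub>v a) \<bullet> x = a \<bullet> (transpose_mat P *\<^sub>v x)"
    if "a \<in> carrier_vec k" "x \<in> carrier_vec n" for a x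
    using transpose_vec_mult_scalar[OF P that] comm_scalar_prod[OF Pv[OF that(1)] that(2)]
      comm_scalar_prod[OF that(1) PTv[OF that(2)]] by simp
  have LBv: "LB *\<^sub>v a = transpose_mat P *\<^sub>v (Lp *\<^sub>v (P *\<^sub>v a))" if "a \<in> carrier_vec k" for a
    unfolding LB_def by (rule principal_submatrix_mult_vec[OF Lp P that])
  have LBq: "a \<bullet> (LB *\<^sub>v a') = (P *\<^sub>v a) \<bullet> (Lp *\<^sub>v (P *\<^sub>v a'))"
    if "a \<in> carrier_vec k" "a' \<in> carrier_vec k" for a a'
    using that by (simp add: LBv adj Lpv Pv)
  have symLp: "x \<bullet> (Lp *\<^sub>v y) = y \<bullet> (Lp *\<^sub>v x)" if "x \<in> carrier_vec n" "y \<in> carrier_vec n" for x y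
    unfolding Lp_def by (rule laplacian_pinv_sym[OF assms(1,2) n that])
  have symLB: "x \<bullet> (LB *\<^sub>v y) = y \<bullet> (LB *\<^sub>v x)" if "x \<in> carrier_vec k" "y \<in> carrier_vec k" for x y
    using that by (simp add: LBq symLp[OF Pv Pv])
  note st = stationary_point[OF pd k b, folded LBi_def, folded tB_def, folded \<alpha>t_def, folded \<kappa>_def]
  have LBi: "LBi *\<^sub>v x \<in> carrier_vec k" if "x \<in> carrier_vec k" for x
    unfolding LBi_def by (rule pos_def_inv_mat_vec(1)[OF pd that])
  have \<alpha>t: "\<alpha>t \<in> carrier_vec k"
    unfolding st(2) using LBi b by simp
  \<comment> \<open>The constant \<open>c\<close> is half the \<alpha>-free double sum of the
    expected loss.\<close>
  obtain c where F: "F (P *\<^sub>v a) = c + \<sigma>2 * q a" if "a \<in> carrier_vec k" for a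
  proof
    fix a :: "real vec" assume a: "a \<in> carrier_vec k"
    \<comment> \<open>The linear terms thereby acquire the same factor \<open>\<sigma>2\<close> as
      the quadratic one; symmetry of \<open>Lp\<close> then merges the two cross terms.\<close>
    have rg: "\<Sigma> *\<^sub>v ones n = \<sigma>2 \<cdot>\<^sub>v g" using \<sigma>2 by (simp add: g_def smult_smult_assoc)
    have "a \<bullet> b = (P *\<^sub>v a) \<bullet> (Lp *\<^sub>v g)" using a g by (simp add: b_def adj Lpv)
    moreover have "(P *\<^sub>v a) \<bullet> (Lp *\<^sub>v (\<Sigma> *\<^sub>v ones n)) = \<sigma>2 * ((P *\<^sub>v a) \<bullet> (Lp *\<^sub>v g))"
      unfolding rg using g Pv[OF a] Lpv[OF g] by (simp add: mult_mat_vec[OF Lp])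
    ultimately show "F (P *\<^sub>v a) = 1 / 2 * (\<Sum>i<n. \<Sum>j<n. Lp $$ (i, j) * \<Sigma> $$ (i, j)) + \<sigma>2 * q a"
      unfolding F_def q_def
        expected_fluctuation_loss[OF assms(5,6,3,4) Lp Pv[OF a], folded \<Sigma>_def, folded \<sigma>2_def]
      using symLp[OF r Pv[OF a]] LBq[OF a a] by (simp add: algebra_simps)
  qed
  have excess: "q a = q \<alpha>t + 1 / 2 * ((a - \<alpha>t) \<bullet> (LB *\<^sub>v (a - \<alpha>t)))"
    if "a \<in> carrier_vec k" "ones k \<bullet> a = 1" for a
    unfolding q_def using quadratic_excess[OF LB symLB that(1) \<alpha>t b that(2) st(3,4)] by simp
  \<comment> \<open>Strictness comes from positive definiteness of \<open>LB\<close> and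
    \<open>\<sigma>2 > 0\<close>; it gives optimality and uniqueness at once.\<close>
  have less: "F (P *\<^sub>v \<alpha>t) < F (P *\<^sub>v a)"
    if a: "a \<in> carrier_vec k" "ones k \<bullet> a = 1" "a \<noteq> \<alpha>t" for a
  proof -
    have "a - \<alpha>t \<noteq> 0\<^sub>v k"
    proof
      assume z: "a - \<alpha>t = 0\<^sub>v k"
      have "a = \<alpha>t"
      proof (rule eq_vecI)
        fix i assume "i < dim_vec \<alpha>t"
        then have "(a - \<alpha>t) $ i = 0" "i < k" using z \<alpha>t by auto
        then show "a $ i = \<alpha>t $ i" using a(1) \<alpha>t by simp
      qed (use a \<alpha>t in simp)
      with a(3) show False ..
    qed
    then have "(a - \<alpha>t) \<bullet> (LB *\<^sub>v (a - \<alpha>t)) > 0"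
      using pd a \<alpha>t by (simp add: pos_def_def)
    then have "q \<alpha>t < q a" using excess[OF a(1,2)] by simp
    then show ?thesis using F[OF \<alpha>t] F[OF a(1)] \<sigma>2 by simp
  qed
  have feas: "feasible n k \<alpha> \<longleftrightarrow> (\<exists>a \<in> carrier_vec k. ones k \<bullet> a = 1 \<and> \<alpha> = P *\<^sub>v a)" for \<alpha>
    unfolding P_def by (rule feasible_iff[OF kn])
  have argmin: "is_arg_min F (feasible n k) \<alpha> \<longleftrightarrow> \<alpha> = P *\<^sub>v \<alpha>t" for \<alpha>
  proof
    assume m: "is_arg_min F (feasible n k) \<alpha>"
    then obtain a where a: "a \<in> carrier_vec k" "ones k \<bullet> a = 1" "\<alpha> = P *\<^sub>v a"
      by (auto simp: is_arg_min_def feas)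
    have "feasible n k (P *\<^sub>v \<alpha>t)" using \<alpha>t st(3) feas by blast
    with m a less[OF a(1,2)] show "\<alpha> = P *\<^sub>v \<alpha>t" by (auto simp: is_arg_min_def)
  next
    assume e: "\<alpha> = P *\<^sub>v \<alpha>t"
    have "\<not> F y < F (P *\<^sub>v \<alpha>t)" if y: "feasible n k y" for y
    proof -
      obtain a where a: "a \<in> carrier_vec k" "ones k \<bullet> a = 1" "y = P *\<^sub>v a" using y feas by blast
      then show ?thesis using less[OF a(1,2)] by (cases "a = \<alpha>t") auto
    qed
    moreover have "feasible n k (P *\<^sub>v \<alpha>t)" using \<alpha>t st(3) feas by blast
    ultimately show "is_arg_min F (feasible n k) \<alpha>" by (auto simp: is_arg_min_def e)
  qed
  have special: "\<alpha>t = transpose_mat P *\<^sub>v g \<and> P *\<^sub>v \<alpha>t = g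
      \<and> (\<forall>v\<in>{..<k} - fluctuating_nodes \<Sigma>. \<alpha>t $ v = 0)"
    if S: "fluctuating_nodes \<Sigma> \<subseteq> {..<k}"
  proof -
    have g0: "g $ v = 0" if "v < n" "v \<notin> fluctuating_nodes \<Sigma>" for v
      using cov_mat_mult_ones_eq_0[OF assms(6) that(1), folded \<Sigma>_def] that carrier_vecD[OF r]
      by (simp add: g_def del: index_mult_mat_vec dim_mult_mat_vec)
    have Pg: "P *\<^sub>v (transpose_mat P *\<^sub>v g) = g"
      unfolding P_def using g kn S by (intro selection_mult_transpose_selection) (auto intro!: g0)
    \<comment> \<open>As \<open>g\<close> is supported on the first \<open>k\<close> nodes,
      restricting and padding returns \<open>g\<close>, so \<open>LB\<close> maps the restriction of
      \<open>g\<close> to \<open>b\<close>.\<close>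
    have "LBi *\<^sub>v (LB *\<^sub>v (transpose_mat P *\<^sub>v g)) = transpose_mat P *\<^sub>v g"
      unfolding LBi_def by (rule pos_def_inv_mat_vec(3)[OF pd PTv[OF g]])
    then have inv: "LBi *\<^sub>v b = transpose_mat P *\<^sub>v g"
      by (simp add: LBv PTv g Pg b_def)
    \<comment> \<open>Normalization by \<open>\<sigma>2\<close> makes \<open>g\<close> satisfy the
      sum constraint already, so the multiplier vanishes.\<close>
    have "ones n \<bullet> g = 1"
      using \<sigma>2 scalar_prod_smult_distrib[OF ones_carrier r, of "1 / \<sigma>2"]
        total_variance_cov_mat[of M n \<omega>, folded \<Sigma>_def, folded \<sigma>2_def]
      by (simp add: g_def)
    moreover have "ones k \<bullet> (transpose_mat P *\<^sub>v g) = ones n \<bullet> (P *\<^sub>v (transpose_mat P *\<^sub>v g))"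
      using transpose_vec_mult_scalar[OF P PTv[OF g] ones_carrier]
      by (simp add: P_def transpose_selection_mult_ones[OF kn])
    ultimately have "\<kappa> = 0" by (simp add: \<kappa>_def inv Pg)
    moreover have "v + 0 \<cdot>\<^sub>v h = v" if "v \<in> carrier_vec k" "h \<in> carrier_vec k" for v h :: "real vec"
      using that by (intro eq_vecI) auto
    ultimately have e: "\<alpha>t = transpose_mat P *\<^sub>v g"
      using PTv[OF g] LBi[OF ones_carrier] st(2) by (simp add: inv)
    moreover have "\<alpha>t $ v = g $ v" if "v < k" for v
      using that g kn by (simp add: e P_def transpose_selection_mult_vec)
    ultimately show ?thesis using Pg g0 kn by auto
  qed
  have "P *\<^sub>v \<alpha>t = \<alpha>t @\<^sub>v 0\<^sub>v (n - k)"
    unfolding P_def by (rule selection_mult_vec[OF \<alpha>t kn])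
  then show ?thesis
    using pos_def_invertible[OF pd] st(1) argmin special
    unfolding Let_def F_def \<alpha>t_def b_def tB_def LBi_def LB_def g_def \<sigma>2_def P_def Lp_def \<Sigma>_def
    by blast
qed

end
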